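(* Let the integers $T(n,k)$, for $n\ge 0$ and $0\le k\le n$, be defined by $T(0,0)=1$, $T(n,0)=1$ and $T(n,n)=0$ for $n>0$, and $T(n,k)=T(n,k-1)+T(n-1,k)$ for $n>1$, $0<k<n$. Then for every integer $n>0$, $$\sum_{k=0}^{n} T(n,k)\,2^{\,n-1-k}=\binom{2n-1}{n}.$$
   Context: The array $T(n,k)$ is the Catalan triangle. In the sum, the term with $k=n$ vanishes since $T(n,n)=0$ for $n>0$. *)

theory Defs
  imports Complex_Main
begin

text \<open>The triangle is only meaningful for \<open>k \<le> n\<close>; entries with \<open>k > n\<close> get the junk value \<open>0\<close>,
  and the recursion never refers to them.\<close>

fun catalan_triangle :: "nat \<Rightarrow> nat \<Rightarrow> int" where
  "catalan_triangle n 0 = 1"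
| "catalan_triangle 0 (Suc k) = 0"
| "catalan_triangle (Suc n) (Suc k) =
     (if k < n then catalan_triangle (Suc n) k + catalan_triangle n (Suc k) else 0)"

lemma catalan_triangle_0_0: "catalan_triangle 0 0 = 1"
  by simp

lemma catalan_triangle_left: "n > 0 \<Longrightarrow> catalan_triangle n 0 = 1"
  by simp

lemma catalan_triangle_diag: "n > 0 \<Longrightarrow> catalan_triangle n n = 0"
  by (cases n) simp_all

lemma catalan_triangle_rec:
  assumes "n > 1" "0 < k" "k < n"
  shows "catalan_triangle n k = catalan_triangle n (k - 1) + catalan_triangle (n - 1) k"
  using assms by (cases n; cases k) simp_all

end

theory Submission
  imports Defs
begin

text \<open>The ballot formula \<open>T(n,k) = C(n+k-1,k) - C(n+k-1,k-1)\<close> together with Pascal's rule shows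
  that the partial sums \<open>\<Sum>k\<le>m. T(n,k) 2^(m-k)\<close> equal \<open>C(n+m,m)\<close> for all \<open>m < n\<close>;
  the claim is the case \<open>m = n - 1\<close>.\<close>

lemma catalan_triangle_Suc_Suc:
  "k \<le> n \<Longrightarrow> catalan_triangle (Suc n) (Suc k)
     = int (Suc (n + k) choose Suc k) - int (Suc (n + k) choose k)"
proof (induction n arbitrary: k)
  case 0
  then show ?case by simp
next
  case (Suc n)
  note row = Suc.IH
  \<comment> \<open>The recurrence uses both the previous row and the previous entry of the same
    row, hence a second induction along the row.\<close>
  from Suc.prems show ?case
  proof (induction k)
    case 0
    then show ?case using row[of 0] by simp
  next
    case (Suc k)
    show ?case
    proof (cases "k < n")
      case True
      then show ?thesis using Suc row[of "Suc k"] by simp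
    next
      case False
      then have "k = n" using Suc.prems by simp
      \<comment> \<open>Diagonal entry: both sides are 0, since the two binomials are the equal
        middle ones of the odd row \<open>2 * n + 3\<close>.\<close>
      then show ?thesis
        using binomial_symmetric[of "Suc (Suc n)" "Suc (Suc n + Suc n)"] by simp
    qed
  qed
qed

lemma catalan_triangle_partial_sum:
  "m < n \<Longrightarrow> (\<Sum>k\<le>m. catalan_triangle n k * 2 ^ (m - k)) = int ((n + m) choose m)"
proof (induction m)
  case 0
  then show ?case by simp
next
  case (Suc m)
  obtain n' where n: "n = Suc n'" using Suc.prems by (cases n) auto
  have "(\<Sum>k\<le>Suc m. catalan_triangle n k * 2 ^ (Suc m - k))
      = 2 * (\<Sum>k\<le>m. catalan_triangle n k * 2 ^ (m - k)) + catalan_triangle n (Suc m)"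
    by (simp add: sum_distrib_left Suc_diff_le mult_ac del: catalan_triangle.simps)
  \<comment> \<open>By the ballot formula, doubling C(n+m,m) and adding C(n+m,m+1) - C(n+m,m) leaves
    C(n+m,m) + C(n+m,m+1): Pascal's rule.\<close>
  also have "\<dots> = int ((n + Suc m) choose Suc m)"
    using Suc catalan_triangle_Suc_Suc[of m n'] by (simp add: n del: catalan_triangle.simps)
  finally show ?case .
qed

theorem theorem2:
  fixes n :: nat
  assumes "n > 0"
  shows "(\<Sum>k=0..n. of_int (catalan_triangle n k) * 2 powi (int n - 1 - int k))
    = (of_nat ((2 * n - 1) choose n) :: rat)"
proof -
  obtain m where n: "n = Suc m" using assms by (cases n) auto
  \<comment> \<open>Only the term \<open>k = n\<close> has a negative exponent, and its coefficient
    is 0; the others become natural powers \<open>m - k\<close>.\<close>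
  have "(\<Sum>k=0..n. of_int (catalan_triangle n k) * 2 powi (int n - 1 - int k))
      = (\<Sum>k\<le>m. of_int (catalan_triangle n k) * (2::rat) powi (int n - 1 - int k))"
    using catalan_triangle_diag[OF assms] by (simp add: n atLeast0AtMost del: catalan_triangle.simps)
  also have "\<dots> = (\<Sum>k\<le>m. of_int (catalan_triangle n k * 2 ^ (m - k)))"
    by (rule sum.cong) (simp_all add: n power_int_def nat_diff_distrib del: catalan_triangle.simps)
  also have "\<dots> = of_nat ((n + m) choose m)"
    by (simp only: of_int_sum[symmetric] catalan_triangle_partial_sum n lessI of_int_of_nat_eq)
  also have "(n + m) choose m = (2 * n - 1) choose n"
    using binomial_symmetric[of m "n + m"] by (simp add: n mult_2)
  finally show ?thesis .
qed

end
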